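(* For all integers $r\geq2$ and $n\ge0$, there is a bijection between $\mathcal{D}_{r,r-1}(n)$ and $\mathcal{A}_{r,r-1}(n)$.
   Context: A partition $\lambda=(\lambda_1,\dots,\lambda_s)$ is a non-increasing finite sequence of positive integers. For a (possibly empty) partition $\mu=(\mu_1,\dots,\mu_t)$ let $\mathrm{sq}(\mu)=\max\{d\ge0:d\le t,\ \mu_d\ge d\}$ (Durfee square side), $\mathrm{rect}(\mu)=\max\{h\ge0:h\le t,\ \mu_h\ge h+1\}$ (height of the horizontal Durfee rectangle with $h$ rows, $h+1$ columns), and, for nonempty $\mu$, $\mathrm{vrect}(\mu)=\max\{k\ge1:k\le t,\ \mu_k\ge k-1\}$ (height of the vertical Durfee rectangle, the largest rectangle with $k$ rows and $k-1$ columns in the top-left corner; $\mathrm{vrect}(\emptyset)=0$). $\mathcal{D}_{r,r-1}(n)$: partitions $\lambda$ of $n$ such that, with $\mu^{(0)}=\lambda$, $\mu^{(1)}$ equal to $\lambda$ with its first $\mathrm{rect}(\lambda)$ parts deleted, and $\mu^{(j)}$ ($j\ge2$) equal to $\mu^{(j-1)}$ with its first $\mathrm{sq}(\mu^{(j-1)})$ parts deleted, $\mu^{(r-1)}$ is empty. $\mathcal{A}_{r,r-1}(n)$: partitions $\lambda$ of $n$ such that, with $\rho^{(0)}=\lambda$, $\rho^{(j)}$ equal to $\rho^{(j-1)}$ with its first $\mathrm{sq}(\rho^{(j-1)})$ parts deleted for $1\le j\le r-2$, and $\rho^{(r-1)}$ equal to $\rho^{(r-2)}$ with its first $k=\mathrm{vrect}(\rho^{(r-2)})$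 parts deleted, (a) $\rho^{(r-1)}$ is empty, and (b) if $\rho^{(r-2)}$ is nonempty, then its $k$-th part (the last row of the vertical Durfee rectangle) equals $k-1$, i.e. it is a part of the partition of length exactly the width of the rectangle. *)

theory Defs
  imports Main
begin

text \<open>
  A partition is the list of its parts. Lists are indexed from 0, so the \<open>d\<close>-th part of \<open>\<mu>\<close>
  is \<open>\<mu> ! (d - 1)\<close>.
\<close>

definition is_partition :: "nat list \<Rightarrow> bool" where
  "is_partition \<mu> \<longleftrightarrow> sorted_wrt (\<ge>) \<mu> \<and> (\<forall>x\<in>set \<mu>. 0 < x)"

definition partitions :: "nat \<Rightarrow> nat list set" where
  "partitions n = {\<mu>. is_partition \<mu> \<and> sum_list \<mu> = n}"

definition sq :: "nat list \<Rightarrow> nat" where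
  "sq \<mu> = Max {d. d = 0 \<or> (1 \<le> d \<and> d \<le> length \<mu> \<and> \<mu> ! (d - 1) \<ge> d)}"

definition rect :: "nat list \<Rightarrow> nat" where
  "rect \<mu> = Max {h. h = 0 \<or> (1 \<le> h \<and> h \<le> length \<mu> \<and> \<mu> ! (h - 1) \<ge> h + 1)}"

definition vrect :: "nat list \<Rightarrow> nat" where
  "vrect \<mu> = (if \<mu> = [] then 0
              else Max {k. 1 \<le> k \<and> k \<le> length \<mu> \<and> \<mu> ! (k - 1) \<ge> k - 1})"

text \<open>The sequence $\mu^{(j)}$: one horizontal Durfee rectangle, then Durfee squares.\<close>

fun rect_sq_seq :: "nat list \<Rightarrow> nat \<Rightarrow> nat list" where
  "rect_sq_seq xs 0 = xs"
| "rect_sq_seq xs (Suc 0) = drop (rect xs) xs"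
| "rect_sq_seq xs (Suc (Suc j)) =
     drop (sq (rect_sq_seq xs (Suc j))) (rect_sq_seq xs (Suc j))"

text \<open>The sequence $\rho^{(j)}$ for \<open>j \<le> r - 2\<close>, where only Durfee squares are removed.\<close>

fun sq_seq :: "nat list \<Rightarrow> nat \<Rightarrow> nat list" where
  "sq_seq xs 0 = xs"
| "sq_seq xs (Suc j) = drop (sq (sq_seq xs j)) (sq_seq xs j)"

text \<open>
  \<open>D_parts r n\<close> and \<open>A_parts r n\<close> are $\mathcal{D}_{r,r-1}(n)$ and $\mathcal{A}_{r,r-1}(n)$;
  both are meant for \<open>r \<ge> 2\<close> only.
\<close>

definition D_parts :: "nat \<Rightarrow> nat \<Rightarrow> nat list set" where
  "D_parts r n = {xs \<in> partitions n. rect_sq_seq xs (r - 1) = []}"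

definition A_parts :: "nat \<Rightarrow> nat \<Rightarrow> nat list set" where
  "A_parts r n = {xs \<in> partitions n.
     let \<rho> = sq_seq xs (r - 2); k = vrect \<rho>
     in drop k \<rho> = [] \<and> (\<rho> \<noteq> [] \<longrightarrow> \<rho> ! (k - 1) = k - 1)}"

end

theory Submission
  imports Defs "HOL-Computational_Algebra.Polynomial"
begin

text \<open>
  Let \<open>g\<^sub>j(N)\<close>, \<open>d\<^sub>j(N)\<close> and \<open>a\<^sub>j(N)\<close> be the generating polynomials of the partitions with parts
  at most \<open>N\<close> that are exhausted by \<open>j\<close> Durfee squares, or lie in $\mathcal{D}_{j+1,j}$ or
  $\mathcal{A}_{j+1,j}$. Splitting off the first Durfee square gives
  \<open>g\<^sub>j\<^sub>+\<^sub>1(N) = \<Sum>M\<le>N. q^(M\<^sup>2) [N choose M] g\<^sub>j(M)\<close> with a Gaussian binomial, and the same for \<open>a\<close>,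
  starting from \<open>g\<^sub>0(N) = 1\<close> and the conventions \<open>a\<^sub>0(N) = q^N\<close>, \<open>d\<^sub>0(N) = 0\<close>. Deleting a largest part \<open>N\<close> shows
  \<open>g\<^sub>j(N) - g\<^sub>j(N - 1) = q^N d\<^sub>j(N)\<close>. The finite identity
  \<open>a\<^sub>j(N) = (1 - q^N) d\<^sub>j(N) + q^N g\<^sub>j(N)\<close> then follows by induction on \<open>j\<close>, and for \<open>N > n\<close> it
  says that \<open>a\<^sub>j\<close> and \<open>d\<^sub>j\<close> have the same coefficient at \<open>q^n\<close>.
\<close>

section \<open>Gaussian binomial coefficients\<close>

definition q :: "int poly" where
  "q = monom 1 1"

text \<open>The Gaussian binomial [l + w choose l]: in an \<open>l\<close> by \<open>w\<close> box,
  the largest row is either shorter than the full width, or it has full width and splits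
  off.\<close>

fun box_poly :: "nat \<Rightarrow> nat \<Rightarrow> int poly" where
  "box_poly 0 w = 1"
| "box_poly (Suc l) 0 = 1"
| "box_poly (Suc l) (Suc w) = box_poly (Suc l) w + q ^ Suc w * box_poly l (Suc w)"

lemma box_poly_0_right [simp]: "box_poly l 0 = 1"
  by (cases l) auto

text \<open>Quotient formulas for neighbouring Gaussian binomials, cleared of denominators. They are
  proved together because the induction step for each uses both at a smaller
  \<open>l + w\<close>.\<close>

lemma box_poly_absorb:
  "(1 - q ^ Suc l) * box_poly (Suc l) w = (1 - q ^ Suc (l + w)) * box_poly l w \<and>
   (1 - q ^ Suc w) * box_poly l (Suc w) = (1 - q ^ Suc (l + w)) * box_poly l w"
proof (induction "l + w" arbitrary: l w rule: less_induct)
  case less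
  have "(1 - q ^ Suc l) * box_poly (Suc l) w = (1 - q ^ Suc (l + w)) * box_poly l w"
  proof (cases w)
    case (Suc v)
    have "(1 - q ^ Suc l) * box_poly (Suc l) v = (1 - q ^ Suc v) * box_poly l (Suc v)"
      using less[of l v] Suc by simp
    then have "(1 - q ^ Suc l) * box_poly (Suc l) w =
        (1 - q ^ Suc v) * box_poly l (Suc v) + (1 - q ^ Suc l) * (q ^ Suc v * box_poly l (Suc v))"
      unfolding Suc box_poly.simps distrib_left by (simp only:)
    also have "\<dots> = (1 - q ^ Suc (l + w)) * box_poly l w"
      unfolding Suc by (simp add: algebra_simps power_add)
    finally show ?thesis .
  qed simp
  moreover have "(1 - q ^ Suc w) * box_poly l (Suc w) = (1 - q ^ Suc (l + w)) * box_poly l w"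
  proof (cases l)
    case (Suc k)
    have "(1 - q ^ Suc k) * box_poly (Suc k) w = (1 - q ^ Suc w) * box_poly k (Suc w)"
      using less[of k w] Suc by simp
    then have "(1 - q ^ Suc w) * box_poly l (Suc w) =
        (1 - q ^ Suc w) * box_poly (Suc k) w + q ^ Suc w * ((1 - q ^ Suc k) * box_poly (Suc k) w)"
      unfolding Suc box_poly.simps distrib_left by (simp only: mult_ac)
    also have "\<dots> = (1 - q ^ Suc (l + w)) * box_poly l w"
      unfolding Suc by (simp add: algebra_simps power_add)
    finally show ?thesis .
  qed simp
  ultimately show ?case ..
qed

text \<open>The value 0 for \<open>M > N\<close> makes the telescoping sum end in 0 and lets sums
  over row \<open>N - 1\<close> run up to \<open>N\<close>.\<close>

definition qbinom :: "nat \<Rightarrow> nat \<Rightarrow> int poly" where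
  "qbinom N M = (if M \<le> N then box_poly M (N - M) else 0)"

lemma qbinom_absorb_col:
  assumes "M \<le> N"
  shows "(1 - q ^ (N - M)) * qbinom N M = (1 - q ^ Suc M) * qbinom N (Suc M)"
proof (cases "M = N")
  case False
  define w where "w = N - Suc M"
  have "N - M = Suc w" "N - Suc M = w"
    using False assms by (auto simp: w_def)
  then show ?thesis
    using False assms box_poly_absorb[of M w] by (simp add: qbinom_def)
qed (simp add: qbinom_def)

text \<open>By absorption, \<open>(1 - q ^ N) * qbinom (N - 1) M\<close> equals
  \<open>(1 - q ^ (N - M)) * qbinom N M\<close>; the difference has the factor
  \<open>q ^ (N - M) - q ^ N\<close>.\<close>

lemma qbinom_diff_row:
  assumes "M \<le> N"
  shows "(1 - q ^ N) * (qbinom N M - qbinom (N - 1) M) = q ^ (N - M) * (1 - q ^ M) * qbinom N M"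
proof (cases "M = N")
  case True
  then show ?thesis
    by (cases N) (auto simp: qbinom_def)
next
  case False
  define w where "w = N - Suc M"
  have w: "N - M = Suc w" "N - 1 - M = w" and N: "N = Suc (M + w)"
    using False assms by (auto simp: w_def)
  have "(1 - q ^ N) * box_poly M w = (1 - q ^ Suc w) * box_poly M (Suc w)"
    using box_poly_absorb[of M w] N by simp
  then show ?thesis
    using w unfolding N qbinom_def by (simp add: algebra_simps power_add)
qed

section \<open>The identity for iterated \<open>q\<close>-binomial sums\<close>

fun iter_sum :: "(nat \<Rightarrow> int poly) \<Rightarrow> nat \<Rightarrow> nat \<Rightarrow> int poly" where
  "iter_sum f 0 N = f N"
| "iter_sum f (Suc j) N = (\<Sum>M\<le>N. q ^ (M * M) * qbinom N M * iter_sum f j M)"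

text \<open>
  After the induction hypothesis is inserted, the difference of the two sides telescopes; its
  partial sums are \<open>T M\<close> below.
\<close>

lemma iter_sum_identity:
  "q ^ N * iter_sum (\<lambda>M. q ^ M) j N =
     (1 - q ^ N) * (iter_sum (\<lambda>_. 1) j N - iter_sum (\<lambda>_. 1) j (N - 1))
     + q ^ N * q ^ N * iter_sum (\<lambda>_. 1) j N"
proof (induction j arbitrary: N)
  case (Suc j)
  let ?a = "iter_sum (\<lambda>M. q ^ M) j" and ?g = "iter_sum (\<lambda>_. 1) j"
  define T where "T M = (1 - q ^ Suc M) * qbinom N (Suc M) * q ^ (Suc M * M) * ?g M" for M
  define F where "F M = (1 - q ^ M) * q ^ (M * (M - 1)) * qbinom N M * ?g M" for M
  have sq: "M * M = M * (M - 1) + M" for M :: nat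
    by (cases M) auto
  have row: "(1 - q ^ N) * (iter_sum (\<lambda>_. 1) (Suc j) N - iter_sum (\<lambda>_. 1) (Suc j) (N - 1))
      = q ^ N * (\<Sum>M\<le>N. F M)"
  proof -
    have "iter_sum (\<lambda>_. 1) (Suc j) (N - 1) = (\<Sum>M\<le>N. q ^ (M * M) * qbinom (N - 1) M * ?g M)"
      by (cases N) (auto simp: qbinom_def)
    then have "(1 - q ^ N) * (iter_sum (\<lambda>_. 1) (Suc j) N - iter_sum (\<lambda>_. 1) (Suc j) (N - 1)) =
        (\<Sum>M\<le>N. q ^ (M * M) * ((1 - q ^ N) * (qbinom N M - qbinom (N - 1) M)) * ?g M)"
      by (simp add: sum_subtractf[symmetric] sum_distrib_left algebra_simps)
    also have "\<dots> = (\<Sum>M\<le>N. q ^ N * F M)"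
    proof (rule sum.cong[OF refl])
      fix M assume "M \<in> {..N}"
      then have M: "M \<le> N" by simp
      then have "q ^ N = q ^ (N - M) * q ^ M"
        by (simp flip: power_add)
      then show "q ^ (M * M) * ((1 - q ^ N) * (qbinom N M - qbinom (N - 1) M)) * ?g M = q ^ N * F M"
        unfolding qbinom_diff_row[OF M] F_def sq[of M] power_add by (simp only: mult_ac)
    qed
    finally show ?thesis
      by (simp add: sum_distrib_left)
  qed
  have step: "q ^ (M * M) * qbinom N M * ?a M =
      F M + q ^ N * (q ^ (M * M) * qbinom N M * ?g M) + (T M - (if M = 0 then 0 else T (M - 1)))"
    if M: "M \<le> N" for M
  proof -
    have N: "q ^ N = q ^ (N - M) * q ^ M"
      using M by (simp flip: power_add)
    \<comment> \<open>The square's weight gives up one factor \<open>q ^ M\<close>, exactly what the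
      induction hypothesis for \<open>?a M\<close> needs.\<close>
    have "q ^ (M * M) * qbinom N M * ?a M = q ^ (M * (M - 1)) * qbinom N M * (q ^ M * ?a M)"
      unfolding sq[of M] power_add by (simp only: mult_ac)
    also have "\<dots> = F M - (1 - q ^ M) * qbinom N M * q ^ (M * (M - 1)) * ?g (M - 1)
        + q ^ (M * M) * q ^ M * qbinom N M * ?g M"
      unfolding Suc.IH F_def sq[of M] power_add by (simp add: algebra_simps)
    also have "(1 - q ^ M) * qbinom N M * q ^ (M * (M - 1)) * ?g (M - 1) =
        (if M = 0 then 0 else T (M - 1))"
      unfolding T_def by (cases M) auto
    \<comment> \<open>Write \<open>q ^ M\<close> as
      \<open>q ^ N + q ^ M * (1 - q ^ (N - M))\<close>; column absorption turns the second summand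
      into \<open>T M\<close>.\<close>
    also have "q ^ (M * M) * q ^ M * qbinom N M * ?g M =
        q ^ N * (q ^ (M * M) * qbinom N M * ?g M) + T M"
      unfolding T_def qbinom_absorb_col[OF M, symmetric] N
      by (simp add: algebra_simps power_add)
    finally show ?thesis
      by (simp add: algebra_simps)
  qed
  have telescope: "(\<Sum>M\<le>K. T M - (if M = 0 then 0 else T (M - 1))) = T K" for K
    by (induction K) auto
  have "T N = 0"
    by (simp add: T_def qbinom_def)
  then have "iter_sum (\<lambda>M. q ^ M) (Suc j) N = (\<Sum>M\<le>N. F M) + q ^ N * iter_sum (\<lambda>_. 1) (Suc j) N"
    using telescope[of N] by (simp add: step sum.distrib sum_distrib_left)
  then show ?case
    unfolding row by (simp add: algebra_simps)
qed simp

section \<open>Generating functions of finite sets of partitions\<close>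

definition gf :: "nat list set \<Rightarrow> int poly" where
  "gf S = (\<Sum>xs\<in>S. q ^ sum_list xs)"

lemma q_power: "q ^ n = monom 1 n"
  by (simp add: q_def monom_power)

lemma coeff_gf:
  assumes "finite S"
  shows "coeff (gf S) n = int (card {xs \<in> S. sum_list xs = n})"
proof -
  have "coeff (gf S) n = (\<Sum>xs\<in>S. if sum_list xs = n then 1 else 0)"
    by (simp add: gf_def coeff_sum q_power)
  also have "\<dots> = (\<Sum>xs\<in>{xs \<in> S. sum_list xs = n}. 1)"
    using assms by (intro sum.inter_filter[symmetric])
  finally show ?thesis by simp
qed

lemma gf_Un_disjoint: "finite S \<Longrightarrow> finite T \<Longrightarrow> S \<inter> T = {} \<Longrightarrow> gf (S \<union> T) = gf S + gf T"
  unfolding gf_def by (rule sum.union_disjoint)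

lemma gf_Cons_image: "gf ((#) x ` S) = q ^ x * gf S"
  by (simp add: gf_def sum.reindex power_add sum_distrib_left)

lemma gf_UN_disjoint:
  assumes "finite I" "\<And>i. i \<in> I \<Longrightarrow> finite (S i)"
    and "\<And>i j. i \<in> I \<Longrightarrow> j \<in> I \<Longrightarrow> i \<noteq> j \<Longrightarrow> S i \<inter> S j = {}"
  shows "gf (\<Union>i\<in>I. S i) = (\<Sum>i\<in>I. gf (S i))"
  unfolding gf_def using assms by (intro sum.UNION_disjoint) auto

text \<open>The common length \<open>l\<close> marks where to cut, so concatenation is injective on
  the product.\<close>

lemma gf_append_image:
  assumes "\<And>xs. xs \<in> S \<Longrightarrow> length xs = l"
  shows "gf ((\<lambda>(xs, ys). xs @ ys) ` (S \<times> T)) = gf S * gf T"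
proof -
  have "inj_on (\<lambda>(xs, ys). xs @ ys) (S \<times> T)"
    using assms by (fastforce simp: inj_on_def)
  then have "gf ((\<lambda>(xs, ys). xs @ ys) ` (S \<times> T)) =
      (\<Sum>(xs, ys)\<in>S \<times> T. q ^ sum_list xs * q ^ sum_list ys)"
    by (simp add: gf_def sum.reindex power_add case_prod_unfold)
  then show ?thesis
    by (simp add: gf_def sum_product sum.cartesian_product)
qed

text \<open>For \<open>l = a = M\<close> and \<open>b = N\<close> these are the rows meeting a
  Durfee square of side \<open>M\<close> in a partition with parts at most \<open>N\<close>.\<close>

definition Box :: "nat \<Rightarrow> nat \<Rightarrow> nat \<Rightarrow> nat list set" where
  "Box l a b = {xs. length xs = l \<and> sorted_wrt (\<ge>) xs \<and> set xs \<subseteq> {a..b}}"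

lemma finite_Box [simp]: "finite (Box l a b)"
  by (rule finite_subset[OF _ finite_lists_length_eq[of "{a..b}" l]]) (auto simp: Box_def)

lemma length_Box: "xs \<in> Box l a b \<Longrightarrow> length xs = l"
  by (simp add: Box_def)

lemma Box_Suc_Suc:
  assumes "a \<le> Suc b"
  shows "Box (Suc l) a (Suc b) = Box (Suc l) a b \<union> (#) (Suc b) ` Box l a (Suc b)" (is "?L = ?R")
proof
  show "?L \<subseteq> ?R"
  proof
    fix xs assume "xs \<in> ?L"
    then obtain x ys where xs: "xs = x # ys" and *: "length ys = l" "sorted_wrt (\<ge>) ys"
      "\<forall>y\<in>set ys. y \<le> x" "x \<in> {a..Suc b}" "set ys \<subseteq> {a..Suc b}"
      by (auto simp: Box_def length_Suc_conv)
    show "xs \<in> ?R"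
    proof (cases "x = Suc b")
      case False
      then have "xs \<in> Box (Suc l) a b"
        using * by (fastforce simp: Box_def xs)
      then show ?thesis ..
    qed (use * in \<open>auto simp: Box_def xs\<close>)
  qed
  show "?R \<subseteq> ?L"
    using assms by (fastforce simp: Box_def)
qed

text \<open>Subtracting \<open>a\<close> from each of the \<open>l\<close> entries accounts for
  \<open>q ^ (l * a)\<close> and leaves an \<open>l\<close> by \<open>w\<close> box.\<close>

lemma gf_Box: "gf (Box l a (a + w)) = q ^ (l * a) * box_poly l w"
proof (induction l w rule: box_poly.induct)
  case (1 w)
  have "Box 0 a (a + w) = {[]}" by (auto simp: Box_def)
  then show ?case by (simp add: gf_def)
next
  case (2 l)
  have "Box (Suc l) a a = {replicate (Suc l) a}"
    by (auto simp: Box_def sorted_wrt_iff_nth_less simp del: replicate_Suc intro!: replicate_eqI)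
  then show ?case by (simp add: gf_def sum_list_replicate del: replicate_Suc)
next
  case (3 l w)
  have "Box (Suc l) a (a + w) \<inter> (#) (Suc (a + w)) ` Box l a (Suc (a + w)) = {}"
    by (auto simp: Box_def)
  then have "gf (Box (Suc l) a (a + Suc w)) =
      gf (Box (Suc l) a (a + w)) + q ^ Suc (a + w) * gf (Box l a (a + Suc w))"
    by (simp add: Box_Suc_Suc gf_Un_disjoint gf_Cons_image del: power_Suc)
  then show ?case
    unfolding 3 by (simp add: algebra_simps power_add)
qed

lemma gf_Box_square: "M \<le> N \<Longrightarrow> gf (Box M M N) = q ^ (M * M) * qbinom N M"
  using gf_Box[of M M "N - M"] by (simp add: qbinom_def)

section \<open>Durfee squares and rectangles\<close>

lemma is_partition_append:
  "is_partition (xs @ ys) \<longleftrightarrow> is_partition xs \<and> is_partition ys \<and> (\<forall>x\<in>set xs. \<forall>y\<in>set ys. y \<le> x)"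
  by (auto simp: is_partition_def sorted_wrt_append)

text \<open>With \<open>sq_split\<close>, this makes the Durfee side the only place where a
  partition can be cut into \<open>M\<close> parts at least \<open>M\<close> and a rest at most
  \<open>M\<close>.\<close>

lemma sq_append:
  assumes "length xs = M" "\<forall>x\<in>set xs. M \<le> x" "\<forall>y\<in>set ys. y \<le> M"
  shows "sq (xs @ ys) = M"
  unfolding sq_def
proof (rule Max_eqI)
  let ?S = "{d. d = 0 \<or> 1 \<le> d \<and> d \<le> length (xs @ ys) \<and> d \<le> (xs @ ys) ! (d - 1)}"
  show "finite ?S"
    by (rule finite_subset[of _ "{..length (xs @ ys)}"]) auto
  show "M \<in> ?S"
    using assms by (cases "M = 0") (auto simp: nth_append)
  fix d assume d: "d \<in> ?S"
  show "d \<le> M"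
  proof (rule ccontr)
    assume "\<not> d \<le> M"
    then have "(xs @ ys) ! (d - 1) \<in> set ys"
      using d assms(1) by (auto simp: nth_append)
    then show False
      using d assms(3) \<open>\<not> d \<le> M\<close> by auto
  qed
qed

lemma sq_split:
  assumes "sorted_wrt (\<ge>) xs"
  shows "sq xs \<le> length xs" "x \<in> set (take (sq xs) xs) \<Longrightarrow> sq xs \<le> x"
    "x \<in> set (drop (sq xs) xs) \<Longrightarrow> x \<le> sq xs"
proof -
  let ?S = "{d. d = 0 \<or> 1 \<le> d \<and> d \<le> length xs \<and> d \<le> xs ! (d - 1)}"
  have fin: "finite ?S"
    by (rule finite_subset[of _ "{..length xs}"]) auto
  have mem: "sq xs \<in> ?S"
    unfolding sq_def by (rule Max_in[OF fin]) auto
  then show "sq xs \<le> length xs" by auto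
  have mono: "xs ! j \<le> xs ! i" if "i \<le> j" "j < length xs" for i j
    using that assms by (cases "i = j") (auto simp: sorted_wrt_iff_nth_less)
  show "sq xs \<le> x" if "x \<in> set (take (sq xs) xs)"
  proof -
    obtain i where i: "i < sq xs" "i < length xs" "x = xs ! i"
      using \<open>x \<in> set (take (sq xs) xs)\<close> by (auto simp: in_set_conv_nth)
    then have "xs ! (sq xs - 1) \<le> x"
      using mem by (auto intro!: mono)
    then show ?thesis using mem i by auto
  qed
  show "x \<le> sq xs" if "x \<in> set (drop (sq xs) xs)"
  proof (rule ccontr)
    assume "\<not> x \<le> sq xs"
    obtain i where i: "sq xs + i < length xs" "x = xs ! (sq xs + i)"
      using \<open>x \<in> set (drop (sq xs) xs)\<close> by (auto simp: in_set_conv_nth less_diff_conv add.commute)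
    then have "Suc (sq xs) \<in> ?S"
      using mono[of "sq xs" "sq xs + i"] \<open>\<not> x \<le> sq xs\<close> by auto
    then have "Suc (sq xs) \<le> sq xs"
      unfolding sq_def using Max_ge[OF fin] by blast
    then show False by simp
  qed
qed

lemma sq_seq_Suc_drop: "sq_seq xs (Suc j) = sq_seq (drop (sq xs) xs) j"
  by (induction j) auto

text \<open>A new first part shifts every index by one, so the rectangle test at \<open>h\<close>
  becomes the square test at \<open>h + 1\<close>; \<open>N\<close> itself only faces the test at
  1.\<close>

lemma sq_Cons_eq_Suc_rect:
  assumes "1 \<le> N"
  shows "sq (N # xs) = Suc (rect xs)"
proof -
  let ?R = "{h. h = 0 \<or> 1 \<le> h \<and> h \<le> length xs \<and> h + 1 \<le> xs ! (h - 1)}"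
  have fin: "finite ?R"
    by (rule finite_subset[of _ "{..length xs}"]) auto
  have "{d. d = 0 \<or> 1 \<le> d \<and> d \<le> length (N # xs) \<and> d \<le> (N # xs) ! (d - 1)} = insert 0 (Suc ` ?R)"
    (is "?S = _")
  proof (rule set_eqI)
    fix d
    show "d \<in> ?S \<longleftrightarrow> d \<in> insert 0 (Suc ` ?R)"
    proof (cases d)
      case (Suc h)
      then show ?thesis using assms by (cases h) auto
    qed simp
  qed
  moreover have "Max (insert 0 (Suc ` ?R)) = Suc (Max ?R)"
  proof -
    have "Max (Suc ` ?R) = Suc (Max ?R)"
      by (rule mono_Max_commute[symmetric]) (use fin in \<open>auto simp: mono_def\<close>)
    moreover have "Suc ` ?R \<noteq> {}" by blast
    ultimately show ?thesis using fin by simp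
  qed
  ultimately show ?thesis
    unfolding sq_def rect_def by simp
qed

text \<open>The first square of \<open>N # xs\<close> takes away \<open>N\<close> and the rows of
  the rectangle of \<open>xs\<close>, so the sequences agree from the first removal on.\<close>

lemma rect_sq_seq_eq_sq_seq_Cons:
  assumes "1 \<le> N"
  shows "rect_sq_seq xs (Suc j) = sq_seq (N # xs) (Suc j)"
  by (induction j) (simp_all add: sq_Cons_eq_Suc_rect[OF assms])

section \<open>Partitions with prescribed remainder\<close>

text \<open>\<open>V\<close> holds the admissible remainders after \<open>j\<close> squares:
  \<open>{[]}\<close> leads to the sums started from 1, \<open>vrect_rests\<close> to those started
  from \<open>q ^ M\<close>.\<close>

definition rest_in :: "nat list set \<Rightarrow> nat \<Rightarrow> nat \<Rightarrow> nat list set" where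
  "rest_in V j N = {xs. is_partition xs \<and> set xs \<subseteq> {..N} \<and> sq_seq xs j \<in> V}"

text \<open>Below a Durfee square of side \<open>M\<close> no part exceeds \<open>M\<close>, so the
  side becomes the size bound of the remainder.\<close>

lemma rest_in_Suc:
  "rest_in V (Suc j) N = (\<Union>M\<le>N. (\<lambda>(xs, ys). xs @ ys) ` (Box M M N \<times> rest_in V j M))"
proof (rule set_eqI, rule iffI)
  fix zs assume zs: "zs \<in> rest_in V (Suc j) N"
  define M where "M = sq zs"
  define xs ys where "xs = take M zs" and "ys = drop M zs"
  have zs_eq: "zs = xs @ ys" by (simp add: xs_def ys_def)
  have sorted: "sorted_wrt (\<ge>) zs"
    using zs by (simp add: rest_in_def is_partition_def)
  have len: "length xs = M"
    using sq_split(1)[OF sorted] by (simp add: xs_def M_def)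
  have ge: "\<forall>x\<in>set xs. M \<le> x" and le: "\<forall>y\<in>set ys. y \<le> M"
    using sq_split(2,3)[OF sorted] by (auto simp: xs_def ys_def M_def)
  have part: "is_partition xs" "is_partition ys" "set xs \<subseteq> {..N}"
    using zs by (auto simp: rest_in_def zs_eq is_partition_append)
  have "M \<le> N"
  proof (cases xs)
    case (Cons x xs')
    then show ?thesis using ge part(3) by force
  qed (use len in simp)
  moreover have "xs \<in> Box M M N"
    using len ge part by (auto simp: Box_def is_partition_def)
  moreover have "ys \<in> rest_in V j M"
    using zs part le sq_seq_Suc_drop[of zs j] by (auto simp: rest_in_def ys_def M_def)
  ultimately show "zs \<in> (\<Union>M\<le>N. (\<lambda>(xs, ys). xs @ ys) ` (Box M M N \<times> rest_in V j M))"
    unfolding zs_eq by blast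
next
  fix zs assume "zs \<in> (\<Union>M\<le>N. (\<lambda>(xs, ys). xs @ ys) ` (Box M M N \<times> rest_in V j M))"
  then obtain M xs ys where M: "M \<le> N" and zs_eq: "zs = xs @ ys"
    and xs: "xs \<in> Box M M N" and ys: "ys \<in> rest_in V j M"
    by auto
  have len: "length xs = M" and ge: "\<forall>x\<in>set xs. M \<le> x"
    using xs by (auto simp: Box_def)
  have le: "\<forall>y\<in>set ys. y \<le> M"
    using ys by (auto simp: rest_in_def)
  \<comment> \<open>Only the lower bound \<open>M = 0\<close> would admit zero entries, and then
    there are no rows.\<close>
  have "0 < x" if "x \<in> set xs" for x
  proof -
    have "0 < M" using that len by (cases xs) auto
    then show ?thesis using ge that by force
  qed
  then have "is_partition xs"
    using xs by (auto simp: Box_def is_partition_def)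
  then have "is_partition zs"
    using ys ge le unfolding zs_eq is_partition_append by (force simp: rest_in_def)
  moreover have "set zs \<subseteq> {..N}"
    using M xs le by (force simp: zs_eq Box_def)
  moreover have "sq_seq zs (Suc j) = sq_seq ys j"
    unfolding sq_seq_Suc_drop zs_eq sq_append[OF len ge le] using len by simp
  ultimately show "zs \<in> rest_in V (Suc j) N"
    using ys by (simp add: rest_in_def)
qed

text \<open>The offset \<open>i\<close> counts the summations already spent on the remainders: 0 for
  the empty one, 1 for vertical rectangles.\<close>

lemma rest_in_gf:
  assumes "\<And>N. finite (rest_in V 0 N)" "\<And>N. gf (rest_in V 0 N) = iter_sum f i N"
  shows "finite (rest_in V j N) \<and> gf (rest_in V j N) = iter_sum f (i + j) N"
proof (induction j arbitrary: N)
  case 0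
  then show ?case using assms by simp
next
  case (Suc j)
  let ?S = "\<lambda>M. (\<lambda>(xs, ys). xs @ ys) ` (Box M M N \<times> rest_in V j M)"
  have fin: "finite (?S M)" for M
    using Suc by simp
  have sq: "sq zs = M" if "zs \<in> ?S M" for zs M
    using that by (auto simp: Box_def rest_in_def intro!: sq_append)
  have "gf (?S M) = q ^ (M * M) * qbinom N M * iter_sum f (i + j) M" if "M \<le> N" for M
    using that Suc by (subst gf_append_image[OF length_Box]) (simp_all add: gf_Box_square)
  moreover have "gf (\<Union>M\<le>N. ?S M) = (\<Sum>M\<le>N. gf (?S M))"
    by (rule gf_UN_disjoint) (use fin sq in blast)+
  ultimately show ?case
    unfolding rest_in_Suc using fin by simp
qed

definition vrect_rests :: "nat list set" where
  "vrect_rests = {\<rho>. drop (vrect \<rho>) \<rho> = [] \<and> (\<rho> \<noteq> [] \<longrightarrow> \<rho> ! (vrect \<rho> - 1) = vrect \<rho> - 1)}"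

text \<open>The rectangle exhausts the list exactly when it reaches the last row, so the maximum
  reduces to the test at that row.\<close>

lemma vrect_eq_length_iff:
  assumes "\<rho> \<noteq> []"
  shows "drop (vrect \<rho>) \<rho> = [] \<longleftrightarrow> length \<rho> - 1 \<le> last \<rho>"
    and "drop (vrect \<rho>) \<rho> = [] \<Longrightarrow> vrect \<rho> = length \<rho>"
proof -
  let ?S = "{k. 1 \<le> k \<and> k \<le> length \<rho> \<and> \<rho> ! (k - 1) \<ge> k - 1}"
  have v: "vrect \<rho> = Max ?S"
    using assms by (simp add: vrect_def)
  have fin: "finite ?S"
    by (rule finite_subset[of _ "{..length \<rho>}"]) auto
  have "1 \<in> ?S"
    using assms by (cases \<rho>) auto
  then have mem: "vrect \<rho> \<in> ?S"
    unfolding v using Max_in[OF fin] by blast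
  then show len: "vrect \<rho> = length \<rho>" if "drop (vrect \<rho>) \<rho> = []"
    using that by auto
  have max: "vrect \<rho> = length \<rho>" if "length \<rho> - 1 \<le> last \<rho>"
    unfolding v using that assms fin
    by (intro Max_eqI) (auto simp: last_conv_nth Suc_le_eq)
  show "drop (vrect \<rho>) \<rho> = [] \<longleftrightarrow> length \<rho> - 1 \<le> last \<rho>"
  proof
    assume "drop (vrect \<rho>) \<rho> = []"
    then have "vrect \<rho> = length \<rho>"
      by (rule len)
    then show "length \<rho> - 1 \<le> last \<rho>"
      using mem assms by (auto simp: last_conv_nth)
  next
    assume "length \<rho> - 1 \<le> last \<rho>"
    then show "drop (vrect \<rho>) \<rho> = []"
      by (simp add: max)
  qed
qed

text \<open>The equality in (b) implies the inequality that (a) amounts to.\<close>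

lemma vrect_rests_iff:
  "\<rho> \<in> vrect_rests \<longleftrightarrow> \<rho> = [] \<or> last \<rho> = length \<rho> - 1"
proof (cases "\<rho> = []")
  case False
  have "\<rho> \<in> vrect_rests \<longleftrightarrow> drop (vrect \<rho>) \<rho> = [] \<and> last \<rho> = length \<rho> - 1"
  proof (cases "drop (vrect \<rho>) \<rho> = []")
    case True
    then show ?thesis
      using vrect_eq_length_iff(2)[OF False True] False by (simp add: vrect_rests_def last_conv_nth)
  qed (simp add: vrect_rests_def)
  then show ?thesis
    unfolding vrect_eq_length_iff(1)[OF False] using False by auto
qed (simp add: vrect_rests_def)

text \<open>
  The empty remainder plays the role of a vertical rectangle of width 0, whose only row has
  length 0 and is therefore not a part.
\<close>

lemma rest_in_vrect_rests:
  "rest_in vrect_rests 0 N =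
     (\<Union>M\<le>N. (\<lambda>(xs, ys). xs @ ys) ` (Box M M N \<times> {if M = 0 then [] else [M]}))"
proof (rule set_eqI, rule iffI)
  fix zs assume zs: "zs \<in> rest_in vrect_rests 0 N"
  show "zs \<in> (\<Union>M\<le>N. (\<lambda>(xs, ys). xs @ ys) ` (Box M M N \<times> {if M = 0 then [] else [M]}))"
  proof (cases zs rule: rev_cases)
    case Nil
    then show ?thesis by (force simp: Box_def intro!: bexI[of _ 0])
  next
    case (snoc xs M)
    then have *: "is_partition (xs @ [M])" "set xs \<subseteq> {..N}" "M \<le> N" "length xs = M"
      using zs by (auto simp: rest_in_def vrect_rests_iff)
    then have "xs \<in> Box M M N" "0 < M"
      by (auto simp: Box_def is_partition_def sorted_wrt_append)
    then show ?thesis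
      using * by (auto simp: snoc image_iff intro!: bexI[of _ M])
  qed
next
  fix zs assume "zs \<in> (\<Union>M\<le>N. (\<lambda>(xs, ys). xs @ ys) ` (Box M M N \<times> {if M = 0 then [] else [M]}))"
  then obtain M xs where "M \<le> N" "xs \<in> Box M M N" "zs = xs @ (if M = 0 then [] else [M])"
    by auto
  moreover from this have "M \<le> x \<and> M \<noteq> 0" if "x \<in> set zs" for x
    using that by (auto simp: Box_def split: if_splits)
  then have "0 < x" if "x \<in> set zs" for x
    using that by fastforce
  ultimately show "zs \<in> rest_in vrect_rests 0 N"
    by (cases "M = 0")
      (auto simp: Box_def rest_in_def vrect_rests_iff is_partition_def sorted_wrt_append)
qed

text \<open>A vertical rectangle whose last row is \<open>M\<close> consists of \<open>M\<close>
  rows meeting a square, followed by the part \<open>M\<close>. It costs one more summation, started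
  from \<open>q ^ M\<close>.\<close>

lemma vrect_gf:
  "finite (rest_in vrect_rests j N) \<and> gf (rest_in vrect_rests j N) = iter_sum (\<lambda>M. q ^ M) (Suc j) N"
proof -
  have fin: "finite (rest_in vrect_rests 0 N)" for N
    unfolding rest_in_vrect_rests by simp
  have "gf (rest_in vrect_rests 0 N) = iter_sum (\<lambda>M. q ^ M) 1 N" for N
  proof -
    define S where "S M = (\<lambda>(xs, ys). xs @ ys) ` (Box M M N \<times> {if M = 0 then [] else [M]})" for M
    have sq: "sq zs = M" if "zs \<in> S M" for zs M
      using that by (auto simp: S_def Box_def intro!: sq_append split: if_splits)
    have "gf (S M) = q ^ (M * M) * qbinom N M * q ^ M" if "M \<le> N" for M
      unfolding S_def using that
      by (subst gf_append_image[OF length_Box]) (auto simp: gf_Box_square gf_def[of "{_}"])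
    moreover have "gf (\<Union>M\<le>N. S M) = (\<Sum>M\<le>N. gf (S M))"
    proof (rule gf_UN_disjoint)
      show "finite (S M)" for M
        by (simp add: S_def)
      show "S i \<inter> S j = {}" if "i \<noteq> j" for i j
        using sq that by blast
    qed simp
    ultimately show ?thesis
      by (simp add: rest_in_vrect_rests S_def)
  qed
  from rest_in_gf[OF fin this] show ?thesis by simp
qed

lemma squares_gf:
  "finite (rest_in {[]} j N) \<and> gf (rest_in {[]} j N) = iter_sum (\<lambda>_. 1) j N"
proof -
  have "rest_in {[]} 0 N = {[]}" for N
    by (auto simp: rest_in_def is_partition_def)
  then show ?thesis
    using rest_in_gf[of "{[]}" "\<lambda>_. 1" 0 j N] by (simp add: gf_def)
qed

text \<open>One rectangle and \<open>j\<close> squares: the generating polynomial is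
  \<open>d\<close> with index \<open>j + 1\<close>.\<close>

definition rect_sq_parts :: "nat \<Rightarrow> nat \<Rightarrow> nat list set" where
  "rect_sq_parts j N = {xs. is_partition xs \<and> set xs \<subseteq> {..N} \<and> rect_sq_seq xs (Suc j) = []}"

text \<open>
  Prepending a part \<open>N\<close> extends the rectangle \<open>h \<times> (h + 1)\<close> to a square of side \<open>h + 1\<close>.
\<close>

lemma squares_with_largest_part:
  assumes "1 \<le> N"
  shows "rest_in {[]} (Suc j) N = rest_in {[]} (Suc j) (N - 1) \<union> (#) N ` rect_sq_parts j N"
    (is "?L = ?R")
proof
  show "?L \<subseteq> ?R"
  proof
    fix xs assume xs: "xs \<in> ?L"
    show "xs \<in> ?R"
    proof (cases "N \<in> set xs")
      case False
      have "set xs \<subseteq> {..N - 1}"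
      proof
        fix x assume "x \<in> set xs"
        then have "x \<le> N" "x \<noteq> N"
          using xs False by (auto simp: rest_in_def)
        then show "x \<in> {..N - 1}" by simp
      qed
      then show ?thesis
        using xs by (simp add: rest_in_def)
    next
      case True
      then obtain x ys where x: "xs = x # ys" by (cases xs) auto
      then have "x = N"
        using xs True by (force simp: rest_in_def is_partition_def)
      then have "ys \<in> rect_sq_parts j N"
        using xs rect_sq_seq_eq_sq_seq_Cons[OF assms, of ys j]
        by (auto simp: x rest_in_def is_partition_def rect_sq_parts_def)
      then show ?thesis
        using x \<open>x = N\<close> by blast
    qed
  qed
  have "N # ys \<in> ?L" if "ys \<in> rect_sq_parts j N" for ys
    using that assms rect_sq_seq_eq_sq_seq_Cons[OF assms, of ys j]
    by (auto simp: rest_in_def is_partition_def rect_sq_parts_def)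
  moreover have "rest_in {[]} (Suc j) (N - 1) \<subseteq> ?L"
    by (force simp: rest_in_def)
  ultimately show "?R \<subseteq> ?L"
    by blast
qed

lemma rect_sq_gf:
  assumes "1 \<le> N"
  shows "finite (rect_sq_parts j N)"
    and "q ^ N * gf (rect_sq_parts j N) =
      iter_sum (\<lambda>_. 1) (Suc j) N - iter_sum (\<lambda>_. 1) (Suc j) (N - 1)"
proof -
  have "finite ((#) N ` rect_sq_parts j N)"
    using squares_gf[of "Suc j" N] unfolding squares_with_largest_part[OF assms] by simp
  then show fin: "finite (rect_sq_parts j N)"
    by (rule finite_imageD) simp
  have "rest_in {[]} (Suc j) (N - 1) \<inter> (#) N ` rect_sq_parts j N = {}"
    using assms by (auto simp: rest_in_def)
  then have "gf (rest_in {[]} (Suc j) N) =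
      gf (rest_in {[]} (Suc j) (N - 1)) + q ^ N * gf (rect_sq_parts j N)"
    unfolding squares_with_largest_part[OF assms] using fin squares_gf
    by (subst gf_Un_disjoint) (auto simp: gf_Cons_image)
  then show "q ^ N * gf (rect_sq_parts j N) =
      iter_sum (\<lambda>_. 1) (Suc j) N - iter_sum (\<lambda>_. 1) (Suc j) (N - 1)"
    using squares_gf by simp
qed

text \<open>The finite identity, arranged to show that the two polynomials differ by a multiple of
  \<open>q ^ N\<close>.\<close>

lemma gf_vrect_eq_gf_rect_sq:
  assumes "1 \<le> N"
  shows "gf (rest_in vrect_rests j N) =
    gf (rect_sq_parts j N) + q ^ N * (gf (rest_in {[]} (Suc j) N) - gf (rect_sq_parts j N))"
proof -
  have nz: "q ^ N \<noteq> 0" by (simp add: q_power)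
  have "q ^ N * gf (rest_in vrect_rests j N) =
      (1 - q ^ N) * (q ^ N * gf (rect_sq_parts j N)) + q ^ N * q ^ N * gf (rest_in {[]} (Suc j) N)"
    using iter_sum_identity[of N "Suc j"] vrect_gf[of j N] squares_gf[of "Suc j" N]
    unfolding rect_sq_gf(2)[OF assms] by simp
  also have "\<dots> =
      q ^ N * (gf (rect_sq_parts j N) + q ^ N * (gf (rest_in {[]} (Suc j) N) - gf (rect_sq_parts j N)))"
    by (simp add: algebra_simps)
  finally show ?thesis
    unfolding mult_left_cancel[OF nz] .
qed

lemma set_partition_le:
  assumes "xs \<in> partitions n"
  shows "set xs \<subseteq> {..Suc n}"
  using assms member_le_sum_list by (fastforce simp: partitions_def)

theorem theorem6p1:
  fixes r n :: nat
  assumes "r \<ge> 2"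
  shows "\<exists>f. bij_betw f (D_parts r n) (A_parts r n)"
proof -
  define j where "j = r - 2"
  \<comment> \<open>A bound of at least \<open>n\<close> excludes no partition of \<open>n\<close>;
    exceeding \<open>n\<close> keeps the multiple of \<open>q ^ N\<close> away from degree
    \<open>n\<close>.\<close>
  define N where "N = Suc n"
  have r: "r - 1 = Suc j" "r - 2 = j" and N: "1 \<le> N" "n < N"
    using assms by (auto simp: j_def N_def)
  have D: "D_parts r n = {xs \<in> rect_sq_parts j N. sum_list xs = n}"
    using set_partition_le[of _ n] unfolding D_parts_def r rect_sq_parts_def N_def
    by (auto simp: partitions_def)
  have A: "A_parts r n = {xs \<in> rest_in vrect_rests j N. sum_list xs = n}"
    using set_partition_le[of _ n] unfolding A_parts_def r rest_in_def N_def
    by (auto simp: partitions_def vrect_rests_def Let_def)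
  have fin: "finite (rect_sq_parts j N)" "finite (rest_in vrect_rests j N)"
    using rect_sq_gf(1)[OF N(1)] vrect_gf by auto
  have "coeff (gf (rest_in vrect_rests j N)) n = coeff (gf (rect_sq_parts j N)) n"
    unfolding gf_vrect_eq_gf_rect_sq[OF N(1)] using N(2) by (simp add: q_power coeff_monom_mult)
  then have "card (D_parts r n) = card (A_parts r n)"
    using fin by (simp add: coeff_gf D A)
  moreover have "finite (D_parts r n)" "finite (A_parts r n)"
    using fin by (simp_all add: D A)
  ultimately show ?thesis
    by (intro finite_same_card_bij)
qed

end
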